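(* A tree is non-reversible if and only if it contains a critical node or an archetypical subtree.
   Context: A tree is a strict partial order $\langle T,<\rangle$ such that for each $t\in T$ the set $(\cdot,t):=\{s\in T:s<t\}$ (also written $(\cdot,t)_T$) is well-ordered or empty. The height $\mathrm{ht}(t)$ of $t$ is the order type of $(\cdot,t)$; $L_\alpha$ is the set of elements of height $\alpha$; the height $\mathrm{ht}(T)$ of $T$ is the least ordinal $\alpha$ with $L_\alpha=\emptyset$; $T|\alpha:=\bigcup_{\beta<\alpha}L_\beta$ with the induced order. A branch is a maximal chain, and its height is its order type. The nodes of $T$ are the equivalence classes of the relation $s\sim t \Leftrightarrow (\cdot,s)=(\cdot,t)$. For $S\subset T$, $S\uparrow:=\{t\in T:\exists s\in S\; t\geq s\}$, with the induced order. $s\parallel t$ means that $s\not\leq t$ and $t\not\leq s$. For sets $A,B$, $A<B$ means $a<b$ for all $a\in A$, $b\in B$. A condensation of a partial order $X$ is a bijection $f:X\to X$ such that $x<y$ implies $f(x)<f(y)$; $\mathrm{Cond}(X)$ is the set of condensations and $\mathrm{Aut}(X)$ the set of automorphisms of $X$. $X$ is reversible iff $\mathrm{Cond}(X)=\mathrm{Aut}(X)$, non-reversible otherwise. A node $N$ of $T$ is critical iff there are $g\in\mathrm{Cond}(N\uparrow)$ and $a\in N$ such that $\mathrm{ht}(a)<\mathrm{ht}(g(a))$. A tree $T$ is archetypical iff $T=\bigcup_{n\in\mathbb{Z}}(P_n\cup T_n)$, where (a1) $\mathrm{ht}(T)=\alpha+2$, where $\alpha>0$ is an ordinal; (a2)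 $P_n$, $n\in\mathbb{Z}$, are different branches in $T|\alpha$ of height $\alpha$; (a3) $P_n<T_n=\{a_n,b_n\}$, for all $n\in\mathbb{Z}$; (a4) $a_n\parallel b_n$ for $n\leq 0$, and $a_n<b_n$ for $n>0$; (a5) there is $g\in\mathrm{Aut}(T|\alpha)$ such that $g[P_n]=P_{n+1}$ for all $n\in\mathbb{Z}$. If such a $T$ (with $P_n,a_n,b_n,g$ as in (a1)–(a5)) is a suborder of a tree $T_1$, then $T$ is an archetypical subtree of $T_1$ iff $(\cdot,a_0)_{T_1}=(\cdot,b_0)_{T_1}=P_0$ and the mapping $F_g:T\to T$ defined by $F_g:=g\cup\{\langle a_n,a_{n+1}\rangle:n\in\mathbb{Z}\}\cup\{\langle b_n,b_{n+1}\rangle:n\in\mathbb{Z}\}$ extends to a condensation of $T_1$. *)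

theory Defs
  imports Main
begin

unbundle cardinal_syntax

text \<open>
  A strict partial order is given by a carrier set \<open>X :: 'a set\<close> and a relation
  \<open>lt :: 'a \<Rightarrow> 'a \<Rightarrow> bool\<close>, of which only the restriction to \<open>X\<close> matters. A suborder is then
  just a smaller carrier with the same \<open>lt\<close>.

  Ordinals are represented, as in the library, by reflexive well-order relations \<open>r\<close>
  (\<open>Well_order r\<close>), compared across types by \<open>=o\<close> (same order type) and \<open><o\<close> (smaller order
  type). The ordinal zero is the empty relation.
\<close>

definition order_on :: "'a set \<Rightarrow> ('a \<Rightarrow> 'a \<Rightarrow> bool) \<Rightarrow> 'a rel" where
  "order_on A lt = {(x, y). x \<in> A \<and> y \<in> A \<and> lt\<^sup>=\<^sup>= x y}"

text \<open>The ordinal successor; \<open>None\<close> is the new top element.\<close>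

definition osuc :: "'a rel \<Rightarrow> 'a option rel" where
  "osuc r = {(Some x, Some y) | x y. (x, y) \<in> r} \<union> {(Some x, None) | x. x \<in> Field r} \<union> {(None, None)}"

lemma Field_osuc: "Field (osuc r) = insert None (Some ` Field r)"
  unfolding osuc_def Field_def by auto

lemma Well_order_osuc:
  assumes "Well_order r"
  shows "Well_order (osuc r)"
proof -
  have r: "Refl r" "trans r" "antisym r" "Total r" "wf (r - Id)"
    using assms by (auto simp: order_on_defs well_order_on_def)
  have wf_osuc: "wf (osuc r - Id)"
  proof (rule wfUNIVI)
    fix P :: "'a option \<Rightarrow> bool" and x
    assume "\<forall>x. (\<forall>y. (y, x) \<in> osuc r - Id \<longrightarrow> P y) \<longrightarrow> P x"
    then have step: "(\<And>y. (y, x) \<in> osuc r - Id \<Longrightarrow> P y) \<Longrightarrow> P x" for x by blast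
    have some: "P (Some a)" for a
    proof (induction a rule: wf_induct_rule[OF r(5)])
      case (1 a)
      then show ?case by - (rule step, auto simp: osuc_def)
    qed
    moreover have "P None"
      using some by - (rule step, auto simp: osuc_def)
    ultimately show "P x" by (cases x) auto
  qed
  have "Refl (osuc r)"
    using r(1) unfolding refl_on_def Field_osuc by (auto simp: osuc_def)
  moreover have "trans (osuc r)"
    by (rule transI) (auto simp: osuc_def intro: FieldI1 dest: transD[OF r(2)])
  moreover have "antisym (osuc r)"
    using r(3) by (auto simp: antisym_def osuc_def)
  moreover have "Total (osuc r)"
    using r(4) unfolding total_on_def Field_osuc by (auto simp: osuc_def)
  moreover have "osuc r \<subseteq> Field (osuc r) \<times> Field (osuc r)"
    by (rule subsetI) (auto intro: FieldI1 FieldI2)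
  ultimately show ?thesis
    using wf_osuc by (simp add: order_on_defs well_order_on_def)
qed

definition preds :: "'a set \<Rightarrow> ('a \<Rightarrow> 'a \<Rightarrow> bool) \<Rightarrow> 'a \<Rightarrow> 'a set" where
  "preds T lt t = {s \<in> T. lt s t}"

text \<open>The empty relation is a well-order on the empty set.\<close>

definition is_tree :: "'a set \<Rightarrow> ('a \<Rightarrow> 'a \<Rightarrow> bool) \<Rightarrow> bool" where
  "is_tree T lt \<longleftrightarrow> irreflp_on T lt \<and> transp_on T lt \<and>
     (\<forall>t\<in>T. well_order_on (preds T lt t) (order_on (preds T lt t) lt))"

definition ht :: "'a set \<Rightarrow> ('a \<Rightarrow> 'a \<Rightarrow> bool) \<Rightarrow> 'a \<Rightarrow> 'a rel" where
  "ht T lt t = order_on (preds T lt t) lt"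

definition level :: "'a set \<Rightarrow> ('a \<Rightarrow> 'a \<Rightarrow> bool) \<Rightarrow> 'b rel \<Rightarrow> 'a set" where
  "level T lt \<alpha> = {t \<in> T. ht T lt t =o \<alpha>}"

text \<open>
  In the next two definitions it is enough to let \<open>\<beta>\<close> range over well-orders on the same type
  as \<open>\<alpha>\<close>, since every ordinal below \<open>\<alpha>\<close> is the order type of an initial segment of \<open>\<alpha>\<close>.
\<close>

definition has_tree_height :: "'a set \<Rightarrow> ('a \<Rightarrow> 'a \<Rightarrow> bool) \<Rightarrow> 'b rel \<Rightarrow> bool" where
  "has_tree_height T lt \<alpha> \<longleftrightarrow> Well_order \<alpha> \<and> level T lt \<alpha> = {} \<and>
     (\<forall>\<beta> :: 'b rel. \<beta> <o \<alpha> \<longrightarrow> level T lt \<beta> \<noteq> {})"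

definition below_level :: "'a set \<Rightarrow> ('a \<Rightarrow> 'a \<Rightarrow> bool) \<Rightarrow> 'b rel \<Rightarrow> 'a set" where
  "below_level T lt \<alpha> = (\<Union>\<beta> \<in> {\<beta> :: 'b rel. \<beta> <o \<alpha>}. level T lt \<beta>)"

abbreviation is_branch :: "'a set \<Rightarrow> ('a \<Rightarrow> 'a \<Rightarrow> bool) \<Rightarrow> 'a set \<Rightarrow> bool" where
  "is_branch T lt B \<equiv> pred_on.maxchain T lt B"

definition nodes :: "'a set \<Rightarrow> ('a \<Rightarrow> 'a \<Rightarrow> bool) \<Rightarrow> 'a set set" where
  "nodes T lt = T // {(s, t). s \<in> T \<and> t \<in> T \<and> preds T lt s = preds T lt t}"

definition up_closure :: "'a set \<Rightarrow> ('a \<Rightarrow> 'a \<Rightarrow> bool) \<Rightarrow> 'a set \<Rightarrow> 'a set" where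
  "up_closure T lt S = {t \<in> T. \<exists>s\<in>S. lt\<^sup>=\<^sup>= s t}"

definition incomparable :: "('a \<Rightarrow> 'a \<Rightarrow> bool) \<Rightarrow> 'a \<Rightarrow> 'a \<Rightarrow> bool" where
  "incomparable lt s t \<longleftrightarrow> \<not> lt\<^sup>=\<^sup>= s t \<and> \<not> lt\<^sup>=\<^sup>= t s"

text \<open>
  Self-maps of \<open>X\<close> are represented by total functions; their values outside \<open>X\<close> are
  irrelevant and unconstrained, in the same way for condensations and automorphisms.
\<close>

definition Cond :: "'a set \<Rightarrow> ('a \<Rightarrow> 'a \<Rightarrow> bool) \<Rightarrow> ('a \<Rightarrow> 'a) set" where
  "Cond X lt = {f. bij_betw f X X \<and> (\<forall>x\<in>X. \<forall>y\<in>X. lt x y \<longrightarrow> lt (f x) (f y))}"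

definition Aut :: "'a set \<Rightarrow> ('a \<Rightarrow> 'a \<Rightarrow> bool) \<Rightarrow> ('a \<Rightarrow> 'a) set" where
  "Aut X lt = {f. bij_betw f X X \<and> (\<forall>x\<in>X. \<forall>y\<in>X. lt x y \<longleftrightarrow> lt (f x) (f y))}"

definition reversible :: "'a set \<Rightarrow> ('a \<Rightarrow> 'a \<Rightarrow> bool) \<Rightarrow> bool" where
  "reversible X lt \<longleftrightarrow> Cond X lt = Aut X lt"

text \<open>Heights are those of \<open>T\<close>; only the condensation lives on the upper closure of \<open>N\<close>.\<close>

definition critical :: "'a set \<Rightarrow> ('a \<Rightarrow> 'a \<Rightarrow> bool) \<Rightarrow> 'a set \<Rightarrow> bool" where
  "critical T lt N \<longleftrightarrow> (\<exists>g \<in> Cond (up_closure T lt N) lt. \<exists>a\<in>N. ht T lt a <o ht T lt (g a))"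

text \<open>
  The conditions for \<open>T\<close> to be an archetypical tree, with the data \<open>\<alpha>\<close>, \<open>P\<^sub>n\<close>, \<open>a\<^sub>n\<close>, \<open>b\<^sub>n\<close>, \<open>g\<close>
  witnessing them. It is no restriction that the ordinal \<open>\<alpha>\<close> is a well-order on the type of the
  elements of \<open>T\<close>, because \<open>\<alpha>\<close> is the order type of the subset \<open>P\<^sub>0\<close> of \<open>T\<close>.
\<close>

definition archetypical_with ::
  "'a set \<Rightarrow> ('a \<Rightarrow> 'a \<Rightarrow> bool) \<Rightarrow> 'a rel \<Rightarrow> (int \<Rightarrow> 'a set) \<Rightarrow> (int \<Rightarrow> 'a) \<Rightarrow> (int \<Rightarrow> 'a) \<Rightarrow>
     ('a \<Rightarrow> 'a) \<Rightarrow> bool" where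
  "archetypical_with T lt \<alpha> P a b g \<longleftrightarrow>
     is_tree T lt \<and>
     T = (\<Union>n. P n \<union> {a n, b n}) \<and>
     Well_order \<alpha> \<and> \<alpha> \<noteq> {} \<and> has_tree_height T lt (osuc (osuc \<alpha>)) \<and>
     inj P \<and> (\<forall>n. is_branch (below_level T lt \<alpha>) lt (P n) \<and> order_on (P n) lt =o \<alpha>) \<and>
     (\<forall>n. \<forall>p \<in> P n. \<forall>t \<in> {a n, b n}. lt p t) \<and>
     (\<forall>n. n \<le> 0 \<longrightarrow> incomparable lt (a n) (b n)) \<and>
     (\<forall>n. n > 0 \<longrightarrow> lt (a n) (b n)) \<and>
     g \<in> Aut (below_level T lt \<alpha>) lt \<and> (\<forall>n. g ` P n = P (n + 1))"

text \<open>The mapping \<open>F\<^sub>g\<close>, as a set of pairs.\<close>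

definition shift_map ::
  "'a set \<Rightarrow> ('a \<Rightarrow> 'a \<Rightarrow> bool) \<Rightarrow> 'a rel \<Rightarrow> (int \<Rightarrow> 'a) \<Rightarrow> (int \<Rightarrow> 'a) \<Rightarrow> ('a \<Rightarrow> 'a) \<Rightarrow> ('a \<times> 'a) set" where
  "shift_map T lt \<alpha> a b g =
     {(x, g x) | x. x \<in> below_level T lt \<alpha>} \<union>
     {(a n, a (n + 1)) | n. True} \<union> {(b n, b (n + 1)) | n. True}"

definition archetypical_subtree :: "'a set \<Rightarrow> 'a set \<Rightarrow> ('a \<Rightarrow> 'a \<Rightarrow> bool) \<Rightarrow> bool" where
  "archetypical_subtree T T1 lt \<longleftrightarrow> T \<subseteq> T1 \<and>
     (\<exists>\<alpha> P a b g. archetypical_with T lt \<alpha> P a b g \<and>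
        preds T1 lt (a 0) = P 0 \<and> preds T1 lt (b 0) = P 0 \<and>
        (\<exists>f \<in> Cond T1 lt. \<forall>(x, y) \<in> shift_map T lt \<alpha> a b g. f x = y))"

end

theory Submission
  imports Defs
begin

text \<open>
  If \<open>N\<close> is critical, a condensation of \<open>N\<up>\<close> that raises a point of \<open>N\<close> extends by the identity to a
  condensation of \<open>T\<close>, which is not an automorphism since automorphisms preserve heights. An
  archetypical subtree comes with a condensation of \<open>T\<close> that maps the incomparable pair
  \<open>a\<^sub>0, b\<^sub>0\<close> to the comparable pair \<open>a\<^sub>1, b\<^sub>1\<close>.

  For the other direction, let \<open>f\<close> be a condensation that is not an automorphism. It never lowers a
  height (\<open>Cond_hgt_le\<close>), and where it preserves heights it also reflects the order
  (\<open>Cond_reflects_less\<close>), so it must raise some height. Let \<open>a\<close> be a raised point of least height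
  \<open>\<alpha>\<close>. Then \<open>f\<close> restricts to an automorphism of \<open>T|\<alpha>\<close>, and the images \<open>P\<^sub>n = f\<^sup>n[(\<cdot>,a)]\<close>, for
  all integers \<open>n\<close>, are downward closed chains of type \<open>\<alpha>\<close>. Moreover \<open>f\<^sup>n\<close> maps the points above
  \<open>P\<^sub>m\<close> onto the points above \<open>P\<^bsub>m+n\<^esub>\<close>.

  If the \<open>P\<^sub>n\<close> are not all different (in particular if \<open>\<alpha> = 0\<close>, when they are
  empty), then \<open>P\<^sub>k = P\<^sub>0\<close> for some \<open>k > 0\<close>, and \<open>f\<^sup>k\<close> is a condensation of
  the cone above \<open>(\<cdot>,a)\<close> that raises \<open>a\<close>: the node of \<open>a\<close> is critical (\<open>critical_node_of_a\<close>).

  If they are all different, consider the point \<open>c\<close> of height \<open>\<alpha>\<close> below \<open>f(a)\<close>. Its preimage \<open>d\<close>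
  lies in the node of \<open>a\<close> (\<open>obtain_partner\<close>). So \<open>d\<close> and \<open>a\<close> are incomparable although
  \<open>f(d) < f(a)\<close>, and the orbits of \<open>d\<close> and \<open>a\<close> together with the chains \<open>P\<^sub>n\<close> form an archetypical
  subtree (\<open>archetypical_subtree_of_inj\<close>).
\<close>

section \<open>Order types of well-orders\<close>

text \<open>
  A self-map of a well-order that preserves the strict order cannot move a point downwards:
  iterating it from such a point would give an infinite descent. If the target had the smaller
  order type, its isomorphism with an initial segment of \<open>r\<close> would produce such a self-map.
\<close>

lemma strict_mono_imp_ordLeq:
  assumes r: "Well_order r" and s: "Well_order s"
    and k: "\<And>x. x \<in> Field r \<Longrightarrow> k x \<in> Field s"
    and mono: "\<And>x y. (x, y) \<in> r \<Longrightarrow> x \<noteq> y \<Longrightarrow> (k x, k y) \<in> s \<and> k x \<noteq> k y"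
  shows "r \<le>o s"
proof (rule ccontr)
  assume "\<not> r \<le>o s"
  then have "s <o r" using r s by (simp add: not_ordLeq_iff_ordLess)
  then obtain c where c: "c \<in> Field r" "s =o Restr r (underS r c)"
    using r s by (auto simp: ordLess_iff_ordIso_Restr)
  then obtain e where e: "iso s (Restr r (underS r c)) e"
    by (auto simp: ordIso_def)
  define m where "m x = e (k x)" for x
  have fld: "Field (Restr r (underS r c)) \<subseteq> underS r c"
    by (rule Field_Restr_subset)
  have inj: "inj_on e (Field s)" and img: "e ` Field s \<subseteq> underS r c"
    using e fld by (auto simp: iso_iff2 bij_betw_def)
  have e_mono: "(x, y) \<in> s \<Longrightarrow> (e x, e y) \<in> r" for x y
    using e FieldI1[of x y s] FieldI2[of x y s] unfolding iso_iff2 by blast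
  have m_mono: "(m x, m y) \<in> r - Id" if "(x, y) \<in> r - Id" for x y
  proof -
    have "(k x, k y) \<in> s" "k x \<noteq> k y" using mono that by auto
    then show ?thesis
      using e_mono inj_on_eq_iff[OF inj FieldI1 FieldI2] by (simp add: m_def)
  qed
  have "m c \<in> underS r c" using k[OF c(1)] img by (auto simp: m_def)
  then have "(m c, c) \<in> r - Id" by (auto simp: underS_def)
  moreover have "wf (r - Id)" using r by (simp add: well_order_on_def)
  ultimately obtain x where "(m x, x) \<in> r - Id"
    "\<And>y. (y, x) \<in> r - Id \<Longrightarrow> (m y, y) \<notin> r - Id"
    using wf_eq_minimal[THEN iffD1, rule_format, of "r - Id" c "{x. (m x, x) \<in> r - Id}"] by blast
  then show False using m_mono by blast
qed

lemma ordLess_osuc: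
  assumes "Well_order r"
  shows "r <o osuc r"
proof -
  have r: "Restr (osuc r) (underS (osuc r) None) = {(Some x, Some y) | x y. (x, y) \<in> r}" (is "?R = _")
    by (auto simp: osuc_def underS_def FieldI1 FieldI2)
  have wo: "Well_order ?R" using Well_order_Restr Well_order_osuc[OF assms] by blast
  have "Field ?R = Some ` Field r" unfolding r Field_def by (auto simp: Domain.simps Range.simps)
  then have "iso r ?R Some" unfolding iso_iff2 r by (auto simp: bij_betw_def)
  then have "r =o ?R" using assms wo by (auto simp: ordIso_def)
  then show ?thesis
    using ordLess_iff_ordIso_Restr[OF Well_order_osuc[OF assms] assms] Field_osuc by blast
qed

text \<open>
  An order type below \<open>osuc r\<close> is that of a proper initial segment of \<open>osuc r\<close>, which omits the new
  top and therefore lives in \<open>r\<close>.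
\<close>

lemma ordLess_osuc_imp_ordLeq:
  assumes "Well_order r" "\<beta> <o osuc r"
  shows "\<beta> \<le>o r"
proof -
  have wo: "Well_order \<beta>" using assms(2) by (auto simp: ordLess_def)
  obtain c where c: "c \<in> Field (osuc r)" "\<beta> =o Restr (osuc r) (underS (osuc r) c)"
    using assms wo by (auto simp: ordLess_iff_ordIso_Restr Well_order_osuc)
  then obtain e where e: "iso \<beta> (Restr (osuc r) (underS (osuc r) c)) e"
    by (auto simp: ordIso_def)
  have below: "\<exists>z. z \<in> Field r \<and> y = Some z" if "y \<in> underS (osuc r) c" for y
    using that by (auto simp: underS_def osuc_def FieldI1 FieldI2)
  have im: "e x \<in> underS (osuc r) c" if "x \<in> Field \<beta>" for x
    using e that Field_Restr_subset[of "osuc r" "underS (osuc r) c"]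
    by (auto simp: iso_iff2 bij_betw_def)
  have inj: "inj_on e (Field \<beta>)" using e by (auto simp: iso_iff2 bij_betw_def)
  show ?thesis
  proof (rule strict_mono_imp_ordLeq[OF wo assms(1), where k = "\<lambda>x. the (e x)"])
    show "the (e x) \<in> Field r" if "x \<in> Field \<beta>" for x using below[OF im[OF that]] by auto
    fix x y assume xy: "(x, y) \<in> \<beta>" "x \<noteq> y"
    then have f: "x \<in> Field \<beta>" "y \<in> Field \<beta>" by (auto simp: FieldI1 FieldI2)
    then have "(e x, e y) \<in> osuc r" "e x \<noteq> e y"
      using e xy inj by (auto simp: iso_iff2 inj_on_def)
    then show "(the (e x), the (e y)) \<in> r \<and> the (e x) \<noteq> the (e y)"
      using below[OF im[OF f(1)]] below[OF im[OF f(2)]] by (auto simp: osuc_def)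
  qed
qed

text \<open>
  Otherwise \<open>osuc s <o osuc r\<close>, and the preceding lemma gives \<open>osuc s \<le>o r \<le>o s\<close>.
\<close>

lemma osuc_ordLeq_osuc:
  assumes "r \<le>o s"
  shows "osuc r \<le>o osuc s"
proof -
  have wo: "Well_order r" "Well_order s" using assms by (auto simp: ordLeq_def)
  show ?thesis
  proof (rule ccontr)
    assume "\<not> osuc r \<le>o osuc s"
    then have "osuc s <o osuc r"
      by (simp add: not_ordLeq_iff_ordLess[OF Well_order_osuc[OF wo(2)] Well_order_osuc[OF wo(1)]])
    then have "osuc s \<le>o r" by (rule ordLess_osuc_imp_ordLeq[OF wo(1)])
    then have "osuc s \<le>o s" using assms by (rule ordLeq_transitive)
    then show False using ordLess_osuc[OF wo(2)] not_ordLess_ordLeq by blast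
  qed
qed

lemma osuc_ordIso_osuc: "r =o s \<Longrightarrow> osuc r =o osuc s"
  using osuc_ordLeq_osuc[of r s] osuc_ordLeq_osuc[of s r] by (simp add: ordIso_iff_ordLeq)

lemma Field_order_on [simp]: "Field (order_on A lt) = A"
  by (auto simp: order_on_def Field_def)

lemma in_order_on: "(x, y) \<in> order_on A lt \<longleftrightarrow> x \<in> A \<and> y \<in> A \<and> (lt x y \<or> x = y)"
  by (auto simp: order_on_def)

lemma Restr_order_on: "B \<subseteq> A \<Longrightarrow> Restr (order_on A lt) B = order_on B lt"
  by (auto simp: order_on_def)

lemma order_on_ordIso_image:
  assumes "Well_order (order_on A lt)" "Well_order (order_on B lt)" "bij_betw k A B"
    and "\<And>x y. x \<in> A \<Longrightarrow> y \<in> A \<Longrightarrow> lt (k x) (k y) \<longleftrightarrow> lt x y"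
  shows "order_on A lt =o order_on B lt"
proof -
  have "iso (order_on A lt) (order_on B lt) k"
    using assms(3,4) unfolding iso_iff2 Field_order_on
    by (auto simp: in_order_on bij_betw_def inj_on_def)
  then show ?thesis using assms by (auto simp: ordIso_def)
qed

lemma order_on_insert_top_ordIso:
  assumes "Well_order (order_on (insert x A) lt)" "\<And>y. y \<in> A \<Longrightarrow> lt y x"
    "irreflp_on (insert x A) lt" "transp_on (insert x A) lt"
  shows "order_on (insert x A) lt =o osuc (order_on A lt)"
proof -
  have xA: "x \<notin> A" using assms(2,3) by (auto simp: irreflp_on_def)
  have top: "\<not> lt x y" if "y \<in> A" for y
    using that assms(2,3,4) unfolding irreflp_on_def transp_on_def by blast
  have "Well_order (order_on A lt)"
    using Well_order_Restr[OF assms(1), of A] by (simp add: Restr_order_on[OF subset_insertI])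
  then have wo: "Well_order (osuc (order_on A lt))" by (rule Well_order_osuc)
  have "iso (osuc (order_on A lt)) (order_on (insert x A) lt) (case_option x id)"
    using xA top assms(2) unfolding iso_iff2 Field_order_on Field_osuc
    by (auto simp: in_order_on osuc_def bij_betw_def inj_on_def image_image)
  then have "osuc (order_on A lt) =o order_on (insert x A) lt"
    using assms wo by (auto simp: ordIso_def)
  then show ?thesis by (rule ordIso_symmetric)
qed

section \<open>Heights and initial segments in a tree\<close>

lemma is_tree_subset:
  assumes T: "is_tree T lt" and "S \<subseteq> T"
  shows "is_tree S lt"
proof -
  have "Well_order (order_on (preds S lt t) lt)" if "t \<in> S" for t
  proof -
    have sub: "preds S lt t \<subseteq> preds T lt t" using assms(2) by (auto simp: preds_def)
    have "Well_order (order_on (preds T lt t) lt)"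
      using assms that by (auto simp: is_tree_def)
    from Well_order_Restr[OF this, of "preds S lt t"] show ?thesis
      by (simp add: Restr_order_on[OF sub])
  qed
  then show ?thesis using assms
    by (auto simp: is_tree_def irreflp_on_def intro: transp_on_subset)
qed

locale tree =
  fixes T :: "'a set" and lt :: "'a \<Rightarrow> 'a \<Rightarrow> bool"  (infix \<open>\<prec>\<close> 50)
  assumes tree: "is_tree T lt"
begin

abbreviation "hgt \<equiv> ht T lt"

definition downset :: "'a set \<Rightarrow> bool" where
  "downset D \<longleftrightarrow> D \<subseteq> T \<and> (\<forall>x\<in>D. \<forall>y\<in>T. y \<prec> x \<longrightarrow> y \<in> D)"

lemma irrefl: "x \<in> T \<Longrightarrow> \<not> x \<prec> x"
  using tree by (auto simp: is_tree_def irreflp_on_def)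

lemma trans: "x \<in> T \<Longrightarrow> y \<in> T \<Longrightarrow> z \<in> T \<Longrightarrow> x \<prec> y \<Longrightarrow> y \<prec> z \<Longrightarrow> x \<prec> z"
  using tree unfolding is_tree_def transp_on_def by blast

lemma asym: "x \<in> T \<Longrightarrow> y \<in> T \<Longrightarrow> x \<prec> y \<Longrightarrow> \<not> y \<prec> x"
  using trans[of x y x] irrefl[of x] by blast

lemma in_preds: "s \<in> preds T lt t \<longleftrightarrow> s \<in> T \<and> s \<prec> t"
  by (simp add: preds_def)

lemma Well_order_hgt: "t \<in> T \<Longrightarrow> Well_order (hgt t)"
  using tree by (simp add: is_tree_def ht_def)

lemma Field_hgt [simp]: "Field (hgt t) = preds T lt t"
  by (simp add: ht_def)

lemma in_hgt: "(x, y) \<in> hgt t \<longleftrightarrow> x \<in> preds T lt t \<and> y \<in> preds T lt t \<and> (x \<prec> y \<or> x = y)"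
  by (simp add: ht_def in_order_on)

lemma Well_order_below: "t \<in> T \<Longrightarrow> B \<subseteq> preds T lt t \<Longrightarrow> Well_order (order_on B lt)"
  using Well_order_Restr[OF Well_order_hgt, of t B] by (simp add: ht_def Restr_order_on)

lemma linear:
  assumes "t \<in> T" "x \<in> T" "y \<in> T" "x \<prec> t" "y \<prec> t"
  shows "x \<prec> y \<or> x = y \<or> y \<prec> x"
proof -
  have "Total (hgt t)" using Well_order_hgt[OF assms(1)] by (simp add: order_on_defs well_order_on_def)
  moreover have "x \<in> preds T lt t" "y \<in> preds T lt t" using assms by (simp_all add: in_preds)
  ultimately show ?thesis by (auto simp: total_on_def in_hgt)
qed

lemma downset_preds: "t \<in> T \<Longrightarrow> downset (preds T lt t)"
  unfolding downset_def preds_def using trans[of _ _ t] by blast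

lemma ofilter_downset:
  assumes "t \<in> T" "B \<subseteq> preds T lt t" "downset B"
  shows "wo_rel.ofilter (hgt t) B"
proof -
  have "wo_rel (hgt t)" using Well_order_hgt[OF assms(1)] by (simp add: wo_rel_def)
  then show ?thesis using assms
    by (auto simp: wo_rel.ofilter_def under_def in_hgt downset_def in_preds)
qed

lemma downset_psubset_ordLess:
  assumes "t \<in> T" "X \<subset> Y" "Y \<subseteq> preds T lt t" "downset X" "downset Y"
  shows "order_on X lt <o order_on Y lt"
proof -
  have "X \<subseteq> preds T lt t" using assms by auto
  then show ?thesis
    using ofilter_subset_ordLess[OF Well_order_hgt[OF assms(1)] ofilter_downset ofilter_downset]
      assms Restr_order_on[of X "preds T lt t" lt] Restr_order_on[of Y "preds T lt t" lt]
    by (simp add: ht_def)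
qed

text \<open>
  Initial segments of the well-order \<open>(\<cdot>,t)\<close> are nested, and a proper one has a smaller type. This is
  how equality of order types is turned into equality of sets below.
\<close>

lemma downset_below_eqI:
  assumes "t \<in> T" "X \<subseteq> preds T lt t" "Y \<subseteq> preds T lt t" "downset X" "downset Y"
    "order_on X lt =o order_on Y lt"
  shows "X = Y"
proof -
  have "wo_rel (hgt t)" using Well_order_hgt[OF assms(1)] by (simp add: wo_rel_def)
  from wo_rel.ofilter_linord[OF this ofilter_downset ofilter_downset] assms
  have "X \<subseteq> Y \<or> Y \<subseteq> X" by blast
  then show ?thesis
    using downset_psubset_ordLess[OF assms(1), of X Y] downset_psubset_ordLess[OF assms(1), of Y X]
      assms not_ordLess_ordIso ordIso_symmetric by blast
qed

lemma hgt_less: "x \<in> T \<Longrightarrow> y \<in> T \<Longrightarrow> x \<prec> y \<Longrightarrow> hgt x <o hgt y"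
  using downset_psubset_ordLess[of y "preds T lt x" "preds T lt y"] downset_preds trans[of _ x y] irrefl[of x]
  by (auto simp: ht_def preds_def psubset_eq)

lemma hgt_eqD: "x \<in> T \<Longrightarrow> y \<in> T \<Longrightarrow> hgt x =o hgt y \<Longrightarrow> \<not> x \<prec> y"
  using hgt_less not_ordLess_ordIso by blast

lemma below_eq_of_hgt_eq:
  "t \<in> T \<Longrightarrow> x \<in> T \<Longrightarrow> y \<in> T \<Longrightarrow> x \<prec> t \<Longrightarrow> y \<prec> t \<Longrightarrow> hgt x =o hgt y \<Longrightarrow> x = y"
  using linear[of t x y] hgt_eqD[of x y] hgt_eqD[of y x] ordIso_symmetric by blast

text \<open>
  A smaller ordinal is the order type of a proper initial segment, which in a downward closed
  chain has the form \<open>(\<cdot>,x)\<close>.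
\<close>

lemma obtain_hgt_below:
  assumes "Well_order (order_on D lt)" "downset D" "\<beta> <o order_on D lt"
  obtains x where "x \<in> D" "hgt x =o \<beta>"
proof -
  have "Well_order \<beta>" using assms(3) by (auto simp: ordLess_def)
  then obtain x where x: "x \<in> D" "\<beta> =o Restr (order_on D lt) (underS (order_on D lt) x)"
    using assms by (auto simp: ordLess_iff_ordIso_Restr)
  have D: "D \<subseteq> T" using assms(2) by (simp add: downset_def)
  have "underS (order_on D lt) x = preds T lt x"
    using x assms(2) irrefl[of x] by (auto simp: underS_def in_order_on preds_def downset_def)
  moreover have "preds T lt x \<subseteq> D" using x(1) assms(2) by (auto simp: preds_def downset_def)
  ultimately have "\<beta> =o hgt x" using x(2) by (simp add: Restr_order_on ht_def)
  then show ?thesis using that x(1) ordIso_symmetric by blast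
qed

text \<open>
  A condensation embeds \<open>(\<cdot>,x)\<close> in \<open>(\<cdot>,f x)\<close>, so it never lowers a height.
\<close>

lemma Cond_hgt_le:
  assumes f: "f \<in> Cond T lt" and x: "x \<in> T"
  shows "hgt x \<le>o hgt (f x)"
proof (rule strict_mono_imp_ordLeq[where k = f])
  have fT: "f z \<in> T" if "z \<in> T" for z using f that by (auto simp: Cond_def bij_betw_def)
  have inj: "inj_on f T" using f by (auto simp: Cond_def bij_betw_def)
  show "Well_order (hgt x)" "Well_order (hgt (f x))" using x fT Well_order_hgt by auto
  show "f z \<in> Field (hgt (f x))" if "z \<in> Field (hgt x)" for z
    using that f fT x by (auto simp: preds_def Cond_def)
  show "(f y, f z) \<in> hgt (f x) \<and> f y \<noteq> f z" if "(y, z) \<in> hgt x" "y \<noteq> z" for y z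
    using that f fT inj x by (auto simp: in_hgt in_preds Cond_def inj_on_def)
qed

lemma Aut_hgt_eq:
  assumes f: "f \<in> Aut T lt" and x: "x \<in> T"
  shows "hgt x =o hgt (f x)"
proof -
  have bij: "bij_betw f T T" and iff: "\<And>y z. y \<in> T \<Longrightarrow> z \<in> T \<Longrightarrow> f y \<prec> f z \<longleftrightarrow> y \<prec> z"
    using f by (auto simp: Aut_def)
  have "f ` preds T lt x = preds T lt (f x)"
  proof (intro equalityI subsetI)
    fix y assume "y \<in> preds T lt (f x)"
    then have y: "y \<in> T" "y \<prec> f x" by (auto simp: preds_def)
    then obtain z where "z \<in> T" "y = f z" using bij by (auto simp: bij_betw_def)
    then show "y \<in> f ` preds T lt x" using y iff x by (auto simp: preds_def)
  qed (use bij iff x in \<open>auto simp: preds_def bij_betw_def\<close>)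
  then have "bij_betw f (preds T lt x) (preds T lt (f x))"
    using bij by (auto simp: bij_betw_def preds_def intro: inj_on_subset)
  moreover have "f x \<in> T" using bij x by (auto simp: bij_betw_def)
  ultimately show ?thesis
    unfolding ht_def using x iff Well_order_hgt
    by (intro order_on_ordIso_image[where k = f]) (auto simp: ht_def preds_def)
qed

lemma reversible_iff_Cond_subset_Aut: "reversible T lt \<longleftrightarrow> Cond T lt \<subseteq> Aut T lt"
  by (auto simp: reversible_def Cond_def Aut_def)

section \<open>Critical nodes and archetypical subtrees give condensations\<close>

text \<open>
  Everything below a point of \<open>N\<up>\<close> lies in \<open>N\<up>\<close> or below all of \<open>N\<close>, because the elements of a
  node have the same predecessors. So a condensation of \<open>N\<up>\<close> can be extended by the identity.
\<close>

lemma critical_imp_not_reversible: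
  assumes N: "N \<in> nodes T lt" and crit: "critical T lt N"
  shows "\<not> reversible T lt"
proof -
  let ?U = "up_closure T lt N"
  obtain g a where g: "g \<in> Cond ?U lt" and a: "a \<in> N" "hgt a <o hgt (g a)"
    using crit by (auto simp: critical_def)
  obtain t where "t \<in> T" and N_def: "N = {s \<in> T. preds T lt t = preds T lt s}"
    using N by (auto simp: nodes_def quotient_def)
  have UT: "?U \<subseteq> T" by (auto simp: up_closure_def)
  have aU: "a \<in> ?U" using a(1) by (auto simp: up_closure_def N_def)
  have gU: "g x \<in> ?U" if "x \<in> ?U" for x using g that by (auto simp: Cond_def bij_betw_def)
  have below: "x \<prec> z" if x: "x \<in> T" "x \<notin> ?U" and y: "y \<in> ?U" "x \<prec> y" and z: "z \<in> ?U" for x y z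
  proof -
    obtain s where s: "s \<in> N" "s = y \<or> s \<prec> y" using y by (auto simp: up_closure_def)
    obtain r where r: "r \<in> N" "r = z \<or> r \<prec> z" using z by (auto simp: up_closure_def)
    have T: "s \<in> T" "r \<in> T" "y \<in> T" "z \<in> T" using s r y z UT by (auto simp: N_def)
    have "\<not> s \<prec> x" "s \<noteq> x" using s(1) x by (auto simp: up_closure_def)
    then have "x \<prec> s" using s(2) y linear[OF T(3) T(1) x(1)] by auto
    then have "x \<in> preds T lt s" using x by (simp add: in_preds)
    then have "x \<prec> r" using s(1) r(1) by (auto simp: N_def in_preds)
    then show ?thesis using r(2) trans[OF x(1) T(2) T(4)] by auto
  qed
  have up: "y \<in> ?U" if xy: "x \<in> ?U" "y \<in> T" "x \<prec> y" for x y
  proof -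
    obtain s where s: "s \<in> N" "s = x \<or> s \<prec> x" using xy by (auto simp: up_closure_def)
    then have "s \<prec> y" using xy UT trans[of s x y] by (auto simp: N_def)
    then show ?thesis using s xy by (auto simp: up_closure_def)
  qed
  define f where "f x = (if x \<in> ?U then g x else x)" for x
  have "bij_betw f ?U ?U"
    using g by (auto simp: f_def Cond_def cong: bij_betw_cong)
  moreover have "bij_betw f (T - ?U) (T - ?U)"
    by (auto simp: f_def bij_betw_def inj_on_def)
  ultimately have "bij_betw f (?U \<union> (T - ?U)) (?U \<union> (T - ?U))"
    by (rule bij_betw_combine) auto
  then have "bij_betw f T T" using UT by (simp add: Un_absorb1)
  moreover have "f x \<prec> f y" if "x \<in> T" "y \<in> T" "x \<prec> y" for x y
    using that g gU[of y] below[of x y "g y"] up[of x y] by (auto simp: f_def Cond_def)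
  ultimately have "f \<in> Cond T lt" by (simp add: Cond_def)
  moreover have "f \<notin> Aut T lt"
    using Aut_hgt_eq[of f a] aU UT a(2) not_ordLess_ordIso by (auto simp: f_def)
  ultimately show ?thesis by (auto simp: reversible_iff_Cond_subset_Aut)
qed

lemma archetypical_subtree_imp_not_reversible:
  assumes "archetypical_subtree S T lt"
  shows "\<not> reversible T lt"
proof -
  obtain \<alpha> P a b g f where ST: "S \<subseteq> T" and arch: "archetypical_with S lt \<alpha> P a b g"
    and f: "f \<in> Cond T lt" and ext: "\<forall>(x, y) \<in> shift_map S lt \<alpha> a b g. f x = y"
    using assms unfolding archetypical_subtree_def by blast
  have S: "S = (\<Union>n. P n \<union> {a n, b n})" and "incomparable lt (a 0) (b 0)" and ab: "a 1 \<prec> b 1"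
    using arch unfolding archetypical_with_def by auto
  then have T: "a 0 \<in> T" "b 0 \<in> T" and "\<not> a 0 \<prec> b 0" using ST by (auto simp: incomparable_def)
  have "(a 0, a (0 + 1)) \<in> shift_map S lt \<alpha> a b g" "(b 0, b (0 + 1)) \<in> shift_map S lt \<alpha> a b g"
    unfolding shift_map_def by blast+
  then have "f (a 0) = a 1" "f (b 0) = b 1" using ext by auto
  then have "f (a 0) \<prec> f (b 0)" using ab by simp
  then have "f \<notin> Aut T lt" using T \<open>\<not> a 0 \<prec> b 0\<close> unfolding Aut_def by blast
  then show ?thesis using f by (auto simp: reversible_iff_Cond_subset_Aut)
qed

section \<open>Assembling an archetypical tree\<close>

text \<open>
  The conditions below leave three things to be derived: the tree height \<open>\<alpha> + 2\<close>, the fact that \<open>T|\<alpha>\<close>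
  is the union of the chains, and their maximality in it. All three rest on one observation: downward
  closed chains of equal type that lie below a common point are equal. Hence inside \<open>S\<close> the point
  \<open>a n\<close> has only \<open>P n\<close> below it, and \<open>b n\<close> has only \<open>P n\<close> and, for \<open>n > 0\<close>, also \<open>a n\<close>; the heights in
  \<open>S\<close> are thus \<open>\<alpha>\<close>, \<open>\<alpha> + 1\<close> and those below \<open>\<alpha>\<close>, even where \<open>a n\<close> is higher in \<open>T\<close>.
\<close>

lemma archetypical_withI:
  fixes P :: "int \<Rightarrow> 'a set" and a b :: "int \<Rightarrow> 'a" and g :: "'a \<Rightarrow> 'a" and \<alpha> :: "'a rel"
  defines "S \<equiv> \<Union>n. P n \<union> {a n, b n}"
  assumes \<alpha>: "\<alpha> \<noteq> {}" and down: "\<And>n. downset (P n)" and type: "\<And>n. order_on (P n) lt =o \<alpha>"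
    and inj: "inj P"
    and aT: "\<And>n. a n \<in> T" and bT: "\<And>n. b n \<in> T"
    and below_a: "\<And>n p. p \<in> P n \<Longrightarrow> p \<prec> a n" and below_b: "\<And>n p. p \<in> P n \<Longrightarrow> p \<prec> b n"
    and incomp: "\<And>n. n \<le> 0 \<Longrightarrow> incomparable lt (a n) (b n)" and ab: "\<And>n. 0 < n \<Longrightarrow> a n \<prec> b n"
    and g_inj: "inj_on g (\<Union>n. P n)"
    and g_iff: "\<And>x y. x \<in> (\<Union>n. P n) \<Longrightarrow> y \<in> (\<Union>n. P n) \<Longrightarrow> g x \<prec> g y \<longleftrightarrow> x \<prec> y"
    and g_P: "\<And>n. g ` P n = P (n + 1)"
  shows "archetypical_with S lt \<alpha> P a b g"
proof -
  have PT: "P n \<subseteq> T" for n using down by (simp add: downset_def)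
  have ST: "S \<subseteq> T" using PT aT bT by (auto simp: S_def)
  interpret S: tree S lt by unfold_locales (rule is_tree_subset[OF tree ST])
  have P_a: "P n \<subseteq> preds T lt (a n)" and P_b: "P n \<subseteq> preds T lt (b n)" for n
    using below_a below_b by (auto simp: in_preds dest: subsetD[OF PT])
  have wo_P: "Well_order (order_on (P n) lt)" for n using P_a aT Well_order_below by blast
  have wo: "Well_order \<alpha>" using type[of 0] by (auto simp: ordIso_def)
  have iso_P: "order_on (P m) lt =o order_on (P n) lt" for m n
    using ordIso_transitive[OF type ordIso_symmetric[OF type]] .
  have same: "m = n" if "t \<in> T" "P m \<subseteq> preds T lt t" "P n \<subseteq> preds T lt t" for m n t
    using downset_below_eqI[OF that down down iso_P] inj by (simp add: inj_eq)
  \<comment> \<open>A point of \<open>P m\<close> above all of \<open>P n\<close> would make \<open>P n\<close> a proper initial segment of \<open>P m\<close>,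
     but the two have the same order type.\<close>
  have not_above: False if x: "x \<in> P m" and above: "P n \<subseteq> preds T lt x" for m n x
  proof -
    have "P n \<subseteq> P m" using above down[of m] x by (auto simp: downset_def in_preds)
    moreover have "x \<notin> P n" using above irrefl[of x] PT x by (auto simp: in_preds)
    ultimately have "P n \<subset> P m" using x by blast
    from downset_psubset_ordLess[OF aT this P_a down down] show False
      using iso_P not_ordLess_ordIso by blast
  qed
  have below_cases: "s \<in> P n \<or> s = a n \<or> s = b n"
    if s: "s \<in> S" "s \<prec> t" and t: "t \<in> T" "P n \<subseteq> preds T lt t" for s t n
  proof -
    have sT: "s \<in> T" using s(1) ST by blast
    obtain m where "s \<in> P m \<or> s = a m \<or> s = b m" using s(1) by (auto simp: S_def)
    then consider "s \<in> P m" | "s = a m \<or> s = b m" by blast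
    then show ?thesis
    proof cases
      case 1
      have "s \<in> P n"
      proof (rule ccontr)
        assume "s \<notin> P n"
        have "q \<in> preds T lt s" if q: "q \<in> P n" for q
        proof -
          have "q \<in> T" "q \<prec> t" using q t(2) by (auto simp: in_preds)
          moreover have "\<not> s \<prec> q" "s \<noteq> q" using \<open>s \<notin> P n\<close> q sT down[of n] by (auto simp: downset_def)
          ultimately show ?thesis using linear[OF t(1) sT, of q] s(2) by (auto simp: in_preds)
        qed
        then show False using not_above[OF 1] by blast
      qed
      then show ?thesis ..
    next
      case 2
      then have "P m \<subseteq> preds T lt s" using P_a P_b by blast
      then have "P m \<subseteq> preds T lt t" using s(2) sT t(1) trans[of _ s t] by (auto simp: in_preds)
      then have "m = n" using same t by blast
      then show ?thesis using 2 by blast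
    qed
  qed
  have PS: "P n \<subseteq> S" and aS: "a n \<in> S" and bS: "b n \<in> S" for n by (auto simp: S_def)
  have nba: "\<not> b n \<prec> a n" for n
    using incomp[of n] ab[of n] asym[OF aT bT, of n n] by (cases "n \<le> 0") (auto simp: incomparable_def)
  have preds_a: "preds S lt (a n) = P n" for n
    using below_cases[OF _ _ aT P_a, of _ n] nba irrefl[OF aT, of n] PS[of n] below_a
    by (auto simp: preds_def)
  have preds_b_nonpos: "preds S lt (b n) = P n" if "n \<le> 0" for n
    using below_cases[OF _ _ bT P_b, of _ n] incomp[OF that] irrefl[OF bT, of n] PS[of n] below_b
    by (auto simp: preds_def incomparable_def)
  have preds_b_pos: "preds S lt (b n) = insert (a n) (P n)" if "0 < n" for n
    using below_cases[OF _ _ bT P_b, of _ n] ab[OF that] irrefl[OF bT, of n] PS[of n] aS[of n] below_b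
    by (auto simp: preds_def)
  have preds_P: "preds S lt p = preds T lt p" if "p \<in> P n" for p n
    using that down[of n] PS[of n] ST by (auto simp: preds_def downset_def)
  have ht_a: "ht S lt (a n) =o \<alpha>" for n using type by (simp add: ht_def preds_a)
  have ht_b_nonpos: "ht S lt (b n) =o \<alpha>" if "n \<le> 0" for n
    using type by (simp add: ht_def preds_b_nonpos[OF that])
  have ht_b_pos: "ht S lt (b n) =o osuc \<alpha>" if "0 < n" for n
  proof -
    have sub: "insert (a n) (P n) \<subseteq> S" using PS aS by blast
    have "Well_order (order_on (insert (a n) (P n)) lt)"
      using S.Well_order_hgt[OF bS, of n] by (simp add: ht_def preds_b_pos[OF that])
    moreover have "irreflp_on (insert (a n) (P n)) lt" "transp_on (insert (a n) (P n)) lt"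
      using S.tree sub unfolding is_tree_def by (auto intro: irreflp_on_subset transp_on_subset)
    ultimately have "order_on (insert (a n) (P n)) lt =o osuc (order_on (P n) lt)"
      using below_a by (intro order_on_insert_top_ordIso) auto
    then show ?thesis
      using ordIso_transitive osuc_ordIso_osuc[OF type] by (simp add: ht_def preds_b_pos[OF that]) blast
  qed
  have ht_P: "ht S lt p <o \<alpha>" if p: "p \<in> P n" for p n
  proof -
    have pT: "p \<in> T" using p PT by blast
    have "preds T lt p \<subset> P n" using p down[of n] irrefl[OF pT] by (auto simp: in_preds downset_def)
    from downset_psubset_ordLess[OF aT this P_a downset_preds[OF pT] down]
    have "ht S lt p <o order_on (P n) lt" by (simp add: ht_def preds_P[OF p])
    then show ?thesis using type ordLess_ordIso_trans by blast
  qed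
  have level_below: "x \<in> below_level S lt \<alpha> \<longleftrightarrow> x \<in> S \<and> ht S lt x <o \<alpha>" for x
    using ordIso_ordLess_trans ordIso_reflexive[OF S.Well_order_hgt]
    by (auto simp: below_level_def level_def)
  have not_low: "\<not> ht S lt (a n) <o \<alpha>" "\<not> ht S lt (b n) <o \<alpha>" for n
  proof -
    show "\<not> ht S lt (a n) <o \<alpha>" using ht_a not_ordLess_ordIso by blast
    show "\<not> ht S lt (b n) <o \<alpha>"
    proof (cases "n \<le> 0")
      case True
      then show ?thesis using ht_b_nonpos not_ordLess_ordIso by blast
    next
      case False
      then have "osuc \<alpha> =o ht S lt (b n)" using ordIso_symmetric[OF ht_b_pos[of n]] by simp
      then have "\<alpha> <o ht S lt (b n)" using ordLess_osuc[OF wo] ordLess_ordIso_trans by blast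
      then show ?thesis using ordLess_transitive ordLess_irreflexive by blast
    qed
  qed
  have low: "below_level S lt \<alpha> = (\<Union>n. P n)"
  proof (intro equalityI subsetI)
    fix x assume "x \<in> below_level S lt \<alpha>"
    then have x: "x \<in> S" "ht S lt x <o \<alpha>" by (simp_all add: level_below)
    then obtain n where "x \<in> P n \<or> x = a n \<or> x = b n" by (auto simp: S_def)
    then show "x \<in> (\<Union>n. P n)" using not_low x(2) by blast
  next
    fix x assume "x \<in> (\<Union>n. P n)"
    then show "x \<in> below_level S lt \<alpha>" using ht_P PS level_below by blast
  qed
  have "has_tree_height S lt (osuc (osuc \<alpha>))"
    unfolding has_tree_height_def
  proof (intro conjI allI impI)
    show "Well_order (osuc (osuc \<alpha>))" by (intro Well_order_osuc wo)
    have lt2: "\<alpha> <o osuc (osuc \<alpha>)" "osuc \<alpha> <o osuc (osuc \<alpha>)"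
      using ordLess_osuc[OF wo] ordLess_osuc[OF Well_order_osuc[OF wo]] ordLess_transitive by blast+
    have "ht S lt x <o osuc (osuc \<alpha>)" if xS: "x \<in> S" for x
    proof -
      obtain n where "x \<in> P n \<or> x = a n \<or> x = b n" using xS by (auto simp: S_def)
      then have "ht S lt x <o \<alpha> \<or> ht S lt x =o \<alpha> \<or> ht S lt x =o osuc \<alpha>"
        using ht_P ht_a ht_b_nonpos ht_b_pos by (cases "n \<le> 0") auto
      then show ?thesis
        using ordLess_transitive[OF _ lt2(1)] ordIso_ordLess_trans[OF _ lt2(1)]
          ordIso_ordLess_trans[OF _ lt2(2)] by blast
    qed
    then show "level S lt (osuc (osuc \<alpha>)) = {}"
      using not_ordLess_ordIso by (auto simp: level_def)
  next
    fix \<beta> :: "'a option option rel" assume "\<beta> <o osuc (osuc \<alpha>)"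
    then have "\<beta> \<le>o osuc \<alpha>" by (rule ordLess_osuc_imp_ordLeq[OF Well_order_osuc[OF wo]])
    then have "\<beta> <o osuc \<alpha> \<or> \<beta> =o osuc \<alpha>" by (simp add: ordLeq_iff_ordLess_or_ordIso)
    moreover have "\<beta> <o osuc \<alpha> \<Longrightarrow> \<beta> <o \<alpha> \<or> \<beta> =o \<alpha>"
      using ordLess_osuc_imp_ordLeq[OF wo, of \<beta>] by (simp add: ordLeq_iff_ordLess_or_ordIso)
    ultimately consider "\<beta> =o osuc \<alpha>" | "\<beta> =o \<alpha>" | "\<beta> <o \<alpha>" by blast
    then show "level S lt \<beta> \<noteq> {}"
    proof cases
      case 1
      have "ht S lt (b 1) =o \<beta>"
        by (rule ordIso_transitive[OF ht_b_pos ordIso_symmetric[OF 1]]) simp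
      then show ?thesis using bS by (auto simp: level_def)
    next
      case 2
      have "ht S lt (a 0) =o \<beta>" by (rule ordIso_transitive[OF ht_a ordIso_symmetric[OF 2]])
      then show ?thesis using aS by (auto simp: level_def)
    next
      case 3
      then have "\<beta> <o order_on (P 0) lt"
        using ordLess_ordIso_trans[OF _ ordIso_symmetric[OF type]] by blast
      then obtain p where p: "p \<in> P 0" "hgt p =o \<beta>" by (rule obtain_hgt_below[OF wo_P down])
      then have "ht S lt p =o \<beta>" by (simp add: ht_def preds_P[OF p(1)])
      then show ?thesis using p(1) PS by (auto simp: level_def)
    qed
  qed
  moreover have "is_branch (below_level S lt \<alpha>) lt (P n)" for n
  proof -
    have "pred_on.chain (\<Union>n. P n) lt (P n)"
      using linear[OF aT[of n]] PT[of n] below_a unfolding pred_on.chain_def by blast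
    moreover have False if C: "pred_on.chain (\<Union>n. P n) lt C" "P n \<subset> C" for C
    proof -
      obtain x where x: "x \<in> C" "x \<notin> P n" using C by blast
      obtain m where m: "x \<in> P m" using C x unfolding pred_on.chain_def by blast
      have "q \<in> preds T lt x" if q: "q \<in> P n" for q
      proof -
        have "q \<prec> x \<or> q = x \<or> x \<prec> q" using C x q unfolding pred_on.chain_def by blast
        moreover have "\<not> x \<prec> q" using x(2) q m PT[of m] down[of n] by (auto simp: downset_def)
        ultimately show ?thesis using q x PT[of n] by (auto simp: in_preds)
      qed
      then show False using not_above[OF m] by blast
    qed
    ultimately show ?thesis unfolding low pred_on.maxchain_def by blast
  qed
  moreover have "g \<in> Aut (below_level S lt \<alpha>) lt"
  proof -
    have "g ` (\<Union>n. P n) = (\<Union>n. P (n + 1))" using g_P by blast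
    also have "\<dots> = (\<Union>n. P n)"
    proof (intro equalityI subsetI)
      fix x assume "x \<in> (\<Union>n. P n)"
      then obtain n where "x \<in> P (n - 1 + 1)" by auto
      then show "x \<in> (\<Union>n. P (n + 1))" by blast
    qed auto
    finally show ?thesis using g_inj g_iff unfolding low Aut_def bij_betw_def by blast
  qed
  ultimately show "archetypical_with S lt \<alpha> P a b g"
    unfolding archetypical_with_def
  proof (intro conjI)
    show "S = (\<Union>n. P n \<union> {a n, b n})" by (simp add: S_def)
  qed (use S.tree wo \<alpha> inj type below_a below_b incomp ab g_P in blast)+
qed

end

section \<open>Integer powers of a bijection\<close>

definition ipow :: "('a \<Rightarrow> 'a) \<Rightarrow> int \<Rightarrow> 'a \<Rightarrow> 'a" where
  "ipow f n = (if 0 \<le> n then f ^^ nat n else inv f ^^ nat (- n))"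

lemma ipow_0 [simp]: "ipow f 0 = id" and ipow_1 [simp]: "ipow f 1 = f"
  by (simp_all add: ipow_def)

lemma ipow_succ:
  assumes "bij f"
  shows "ipow f (n + 1) x = f (ipow f n x)"
proof (cases "0 \<le> n")
  case True
  then show ?thesis by (simp add: ipow_def nat_add_distrib)
next
  case False
  then have "nat (- n) = Suc (nat (- (n + 1)))" by simp
  then have "f (ipow f n x) = (inv f ^^ nat (- (n + 1))) x"
    using False assms by (simp add: ipow_def bij_is_surj surj_f_inv_f)
  then show ?thesis using False by (cases "n = -1") (simp_all add: ipow_def)
qed

text \<open>
  Stated for a binary relation since the invariants needed later compare the images of two points.
\<close>

lemma ipow_invariant:
  assumes f: "bij f" and Q: "\<And>x y. Q (f x) (f y) \<longleftrightarrow> Q x y"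
  shows "Q (ipow f n x) (ipow f n y) \<longleftrightarrow> Q x y"
proof (induction n rule: int_induct[where k = 0])
  case (step2 i)
  then show ?case using Q ipow_succ[OF f, of "i - 1"] by simp
qed (use Q ipow_succ[OF f] in simp_all)

lemma ipow_add:
  assumes f: "bij f"
  shows "ipow f (m + n) x = ipow f m (ipow f n x)"
proof (induction m rule: int_induct[where k = 0])
  case (step1 i)
  then show ?case using ipow_succ[OF f, of "i + n"] ipow_succ[OF f, of i] by (simp add: ac_simps)
next
  case (step2 i)
  have "f (ipow f (i - 1 + n) x) = f (ipow f (i - 1) (ipow f n x))"
    using step2 ipow_succ[OF f, of "i - 1 + n"] ipow_succ[OF f, of "i - 1"] by simp
  then show ?case using f by (simp add: bij_is_inj inj_eq)
qed simp

lemma ipow_inverse: "bij f \<Longrightarrow> ipow f n (ipow f (- n) x) = x"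
  using ipow_add[of f n "- n" x] by simp

lemma bij_ipow:
  assumes "bij f"
  shows "bij (ipow f n)"
proof (rule o_bij)
  show "ipow f (- n) \<circ> ipow f n = id" using ipow_inverse[OF assms, of "- n"] by auto
  show "ipow f n \<circ> ipow f (- n) = id" using ipow_inverse[OF assms, of n] by auto
qed

section \<open>Condensations where they preserve heights\<close>

context tree
begin

text \<open>
  Where \<open>f\<close> preserves heights it also reflects the order: if \<open>f p \<prec> f x\<close>, then the predecessor of
  \<open>x\<close> at the height of \<open>p\<close> and \<open>p\<close> itself have images of the same height below \<open>f x\<close>, and a chain
  contains only one such point. The set \<open>L\<close> will be all of \<open>T\<close>, or \<open>T|\<alpha>\<close> where \<open>\<alpha>\<close> is the least height
  of a raised point.
\<close>

lemma Cond_reflects_less: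
  assumes f: "f \<in> Cond T lt"
    and L: "L \<subseteq> T" "\<forall>z\<in>T. \<forall>w\<in>L. hgt z \<le>o hgt w \<longrightarrow> z \<in> L"
    and pres: "\<forall>z\<in>L. hgt z =o hgt (f z)"
    and p: "p \<in> L" and x: "x \<in> T" and less: "f p \<prec> f x"
  shows "p \<prec> x"
proof -
  have fT: "f z \<in> T" if "z \<in> T" for z using f that by (auto simp: Cond_def bij_betw_def)
  have inj: "inj_on f T" using f by (auto simp: Cond_def bij_betw_def)
  have pT: "p \<in> T" using p L(1) by blast
  have "\<not> hgt x \<le>o hgt p"
  proof
    assume le: "hgt x \<le>o hgt p"
    then have "hgt (f x) =o hgt x" using L(2) x p pres ordIso_symmetric by blast
    then have "hgt (f x) \<le>o hgt p" using le ordIso_ordLeq_trans by blast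
    then have "hgt (f x) \<le>o hgt (f p)" using pres p ordLeq_ordIso_trans by blast
    then show False using hgt_less[OF fT[OF pT] fT[OF x] less] not_ordLess_ordLeq by blast
  qed
  then have "hgt p <o hgt x"
    using not_ordLeq_iff_ordLess Well_order_hgt[OF pT] Well_order_hgt[OF x] by blast
  then obtain q where "q \<in> preds T lt x" and q: "hgt q =o hgt p"
    using obtain_hgt_below[OF _ downset_preds[OF x], of "hgt p"] Well_order_hgt[OF x]
    unfolding ht_def[of T lt x] by blast
  then have qT: "q \<in> T" and "q \<prec> x" by (auto simp: in_preds)
  have "q \<in> L" using L(2) qT p ordIso_imp_ordLeq[OF q] by blast
  then have "hgt (f q) =o hgt q" using pres ordIso_symmetric by blast
  then have "hgt (f q) =o hgt p" using q by (rule ordIso_transitive)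
  moreover have "hgt p =o hgt (f p)" using pres p by blast
  ultimately have "hgt (f q) =o hgt (f p)" by (rule ordIso_transitive)
  moreover have "f q \<prec> f x" using f qT x \<open>q \<prec> x\<close> by (auto simp: Cond_def)
  ultimately have "f q = f p"
    using below_eq_of_hgt_eq[of "f x" "f q" "f p"] fT qT pT x less by blast
  then have "q = p" using inj qT pT by (auto simp: inj_on_def)
  then show ?thesis using \<open>q \<prec> x\<close> by blast
qed

lemma Cond_preserving_hgt_imp_Aut:
  assumes f: "f \<in> Cond T lt" and pres: "\<And>x. x \<in> T \<Longrightarrow> hgt x =o hgt (f x)"
  shows "f \<in> Aut T lt"
proof -
  have "x \<prec> y" if "x \<in> T" "y \<in> T" "f x \<prec> f y" for x y
    using Cond_reflects_less[OF f subset_refl, of x y] pres that by blast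
  then show ?thesis using f by (auto simp: Cond_def Aut_def)
qed

text \<open>
  A point above \<open>(\<cdot>,a)\<close> is in the node of \<open>a\<close>, or its predecessor at the height of \<open>a\<close> is. The right-hand
  side refers to the chain \<open>(\<cdot>,a)\<close> alone, so it can be followed along the powers of a condensation,
  while the node itself need not be mapped to a node.
\<close>

lemma up_closure_same_preds:
  assumes a: "a \<in> T"
  shows "up_closure T lt {t \<in> T. preds T lt a = preds T lt t} = {t \<in> T. \<forall>p \<in> preds T lt a. p \<prec> t}"
    (is "up_closure T lt ?N = ?U")
proof (intro equalityI subsetI)
  fix t assume "t \<in> up_closure T lt ?N"
  then obtain s where t: "t \<in> T" and s: "s \<in> T" "preds T lt a = preds T lt s" "s = t \<or> s \<prec> t"
    by (auto simp: up_closure_def)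
  then show "t \<in> ?U" using trans[of _ s t] by (auto simp: in_preds)
next
  fix t assume "t \<in> ?U"
  then have t: "t \<in> T" and sub: "preds T lt a \<subseteq> preds T lt t" by (auto simp: in_preds)
  show "t \<in> up_closure T lt ?N"
  proof (cases "preds T lt a = preds T lt t")
    case True
    then show ?thesis using t by (auto simp: up_closure_def)
  next
    case False
    then have "order_on (preds T lt a) lt <o order_on (preds T lt t) lt"
      using downset_psubset_ordLess[OF t _ subset_refl downset_preds[OF a] downset_preds[OF t]] sub
      by blast
    then obtain c where "c \<in> preds T lt t" and c: "hgt c =o hgt a"
      using obtain_hgt_below[OF _ downset_preds[OF t]] Well_order_hgt[OF t] unfolding ht_def by blast
    then have cT: "c \<in> T" and ct: "c \<prec> t" by (auto simp: in_preds)
    then have "preds T lt c \<subseteq> preds T lt t" using trans[OF _ cT t] by (auto simp: in_preds)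
    then have "preds T lt a = preds T lt c"
      using downset_below_eqI[OF t sub _ downset_preds[OF a] downset_preds[OF cT]]
        ordIso_symmetric[OF c] by (simp add: ht_def)
    then show ?thesis using cT ct t by (auto simp: up_closure_def)
  qed
qed

end

section \<open>A lowest point whose height is raised\<close>

text \<open>
  The map is a bijection of the whole type, and not only of \<open>T\<close>, so that its negative powers exist as
  functions and the orbits of points are indexed by the integers.
\<close>

locale lowest_raised = tree +
  fixes f :: "'a \<Rightarrow> 'a" and a :: 'a
  assumes f_Cond: "f \<in> Cond T lt" and bij: "bij f"
    and a: "a \<in> T" and raised: "hgt a <o hgt (f a)"
    and lowest: "\<And>x. x \<in> T \<Longrightarrow> hgt x <o hgt a \<Longrightarrow> hgt x =o hgt (f x)"
begin

abbreviation "F \<equiv> ipow f"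

definition low :: "'a set" where
  "low = {x \<in> T. hgt x <o hgt a}"

definition P :: "int \<Rightarrow> 'a set" where
  "P n = F n ` preds T lt a"

lemma low_T: "low \<subseteq> T"
  by (auto simp: low_def)

lemma f_T_iff: "f x \<in> T \<longleftrightarrow> x \<in> T"
proof -
  have "f ` T = T" using f_Cond by (simp add: Cond_def bij_betw_def)
  then show ?thesis using bij_is_inj[OF bij] inj_image_mem_iff by metis
qed

lemma F_T_iff: "F n x \<in> T \<longleftrightarrow> x \<in> T"
  using ipow_invariant[OF bij, of "\<lambda>x y. x \<in> T"] f_T_iff by blast

text \<open>
  As \<open>f\<close> never lowers a height and leaves the heights below that of \<open>a\<close> unchanged, no point
  crosses the boundary of \<open>low\<close> in either direction.
\<close>

lemma f_low_iff: "f x \<in> low \<longleftrightarrow> x \<in> low"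
proof
  assume "f x \<in> low"
  then have "x \<in> T" "hgt (f x) <o hgt a" using f_T_iff by (auto simp: low_def)
  then show "x \<in> low" using Cond_hgt_le[OF f_Cond] ordLeq_ordLess_trans by (auto simp: low_def)
next
  assume "x \<in> low"
  then have x: "x \<in> T" "hgt x <o hgt a" by (auto simp: low_def)
  then show "f x \<in> low"
    using f_T_iff ordIso_ordLess_trans[OF ordIso_symmetric[OF lowest[OF x]] x(2)]
    by (auto simp: low_def)
qed

lemma F_low_iff: "F n x \<in> low \<longleftrightarrow> x \<in> low"
  using ipow_invariant[OF bij, of "\<lambda>x y. x \<in> low"] f_low_iff by blast

text \<open>
  Only the smaller point has to be low. This is what makes chains in \<open>low\<close> and the points above them
  correspond under all powers of \<open>f\<close>, although \<open>f\<close> may raise the latter.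
\<close>

lemma f_less_iff:
  assumes p: "p \<in> low" and x: "x \<in> T"
  shows "f p \<prec> f x \<longleftrightarrow> p \<prec> x"
proof
  have closed: "\<forall>z\<in>T. \<forall>w\<in>low. hgt z \<le>o hgt w \<longrightarrow> z \<in> low"
    using ordLeq_ordLess_trans by (auto simp: low_def)
  have pres: "\<forall>z\<in>low. hgt z =o hgt (f z)" using lowest by (auto simp: low_def)
  assume "f p \<prec> f x"
  then show "p \<prec> x" by (rule Cond_reflects_less[OF f_Cond low_T closed pres p x])
next
  assume "p \<prec> x"
  then show "f p \<prec> f x" using f_Cond p x low_T by (auto simp: Cond_def)
qed

lemma F_less_iff:
  assumes p: "p \<in> low" and x: "x \<in> T"
  shows "F n p \<prec> F n x \<longleftrightarrow> p \<prec> x"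
proof -
  have "f p \<in> low \<and> f x \<in> T \<and> f p \<prec> f x \<longleftrightarrow> p \<in> low \<and> x \<in> T \<and> p \<prec> x" for p x
    using f_low_iff f_T_iff f_less_iff by blast
  from ipow_invariant[of f "\<lambda>p x. p \<in> low \<and> x \<in> T \<and> p \<prec> x", OF bij this]
  show ?thesis using p x F_low_iff F_T_iff by blast
qed

text \<open>
  For arbitrary points only the positive powers preserve the order; the inverse of \<open>f\<close> need not.
\<close>

lemma F_mono:
  assumes n: "0 \<le> n" and xy: "x \<in> T" "y \<in> T" "x \<prec> y"
  shows "F n x \<prec> F n y"
  using n
proof (induction n rule: int_ge_induct)
  case (step i)
  then have "f (F i x) \<prec> f (F i y)" using f_Cond F_T_iff xy by (auto simp: Cond_def)
  then show ?case by (simp add: ipow_succ[OF bij])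
qed (use xy in simp)

lemma F_image_T: "F n ` {x \<in> T. R x} = {y \<in> T. R (F (- n) y)}"
proof (intro equalityI subsetI)
  fix y assume "y \<in> {y \<in> T. R (F (- n) y)}"
  then have "F (- n) y \<in> {x \<in> T. R x}" using F_T_iff by simp
  then show "y \<in> F n ` {x \<in> T. R x}" using ipow_inverse[OF bij, of n y] by (metis imageI)
qed (use F_T_iff ipow_inverse[OF bij, of "- n" for n] in auto)

lemma F_Cond: "0 \<le> n \<Longrightarrow> F n \<in> Cond T lt"
  using F_image_T[of n "\<lambda>_. True"] bij_is_inj[OF bij_ipow[OF bij, of n]] F_mono
  by (auto simp: Cond_def bij_betw_def intro: inj_on_subset)

lemma preds_a_low: "preds T lt a \<subseteq> low"
  using hgt_less[OF _ a] by (auto simp: low_def in_preds)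

lemma P_low: "P n \<subseteq> low"
  using preds_a_low F_low_iff by (auto simp: P_def)

lemma P_0: "P 0 = preds T lt a"
  by (simp add: P_def)

lemma P_add: "P (m + n) = F m ` P n"
  by (auto simp: P_def ipow_add[OF bij] image_image)

lemma in_P_iff: "F n x \<in> P n \<longleftrightarrow> x \<in> T \<and> x \<prec> a"
  using inj_image_mem_iff[OF bij_is_inj[OF bij_ipow[OF bij]]] by (auto simp: P_def in_preds)

lemma downset_low: "x \<in> low \<Longrightarrow> y \<in> T \<Longrightarrow> y \<prec> x \<Longrightarrow> y \<in> low"
  using hgt_less[of y x] ordLess_transitive[of "hgt y" "hgt x" "hgt a"] by (auto simp: low_def)

text \<open>
  A predecessor of a point of \<open>P n\<close> is low, so its preimage under \<open>F n\<close> is low too and, as the order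
  is reflected there, lies below \<open>a\<close>.
\<close>

lemma downset_P: "downset (P n)"
  unfolding downset_def
proof (intro conjI ballI impI)
  show "P n \<subseteq> T" using P_low low_T by blast
  fix x y assume x: "x \<in> P n" and y: "y \<in> T" "y \<prec> x"
  obtain u where u: "x = F n u" "u \<in> T" "u \<prec> a" using x by (auto simp: P_def in_preds)
  define v where "v = F (- n) y"
  have yv: "y = F n v" using ipow_inverse[OF bij] by (simp add: v_def)
  have "y \<in> low" using downset_low x y P_low by blast
  then have v: "v \<in> low" "v \<in> T" using F_low_iff low_T unfolding yv by blast+
  then have "v \<prec> u" using y(2) F_less_iff[of v u n] u by (simp add: yv)
  then have "v \<prec> a" using trans[OF v(2) u(2) a] u by blast
  then show "y \<in> P n" using in_P_iff v by (simp add: yv)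
qed

lemma above_P_iff: "x \<in> T \<Longrightarrow> (\<forall>p \<in> P n. p \<prec> F n x) \<longleftrightarrow> (\<forall>p \<in> preds T lt a. p \<prec> x)"
  by (auto simp: P_def F_less_iff[OF subsetD[OF preds_a_low]])

lemma P_subset_preds: "P n \<subseteq> preds T lt (F n a)"
  using above_P_iff[OF a, of n] P_low[of n] low_T by (auto simp: in_preds)

lemma P_type: "order_on (P n) lt =o hgt a"
proof -
  have "bij_betw (F n) (preds T lt a) (P n)"
    using bij_is_inj[OF bij_ipow[OF bij]] by (auto simp: P_def bij_betw_def intro: inj_on_subset)
  moreover have "Well_order (order_on (P n) lt)"
    using Well_order_below[OF _ P_subset_preds, of n] F_T_iff a by blast
  moreover have "F n x \<prec> F n y \<longleftrightarrow> x \<prec> y" if "x \<in> preds T lt a" "y \<in> preds T lt a" for x y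
    using F_less_iff[of x y n] that preds_a_low by (auto simp: in_preds)
  ultimately have "hgt a =o order_on (P n) lt"
    using Well_order_hgt[OF a] unfolding ht_def
    by (intro order_on_ordIso_image[where k = "F n"]) auto
  then show ?thesis by (rule ordIso_symmetric)
qed

text \<open>
  If some positive power \<open>F k\<close> fixes the chain \<open>P 0 = (\<cdot>,a)\<close> as a set, it maps the set of points
  above the chain, which is the cone over the node of \<open>a\<close>, onto itself; and it raises \<open>a\<close>.
\<close>

lemma critical_node_of_a:
  assumes k: "0 < k" "P k = P 0"
  shows "\<exists>N \<in> nodes T lt. critical T lt N"
proof
  let ?N = "{t \<in> T. preds T lt a = preds T lt t}" and ?U = "{t \<in> T. \<forall>p \<in> preds T lt a. p \<prec> t}"
  show "?N \<in> nodes T lt" using a by (auto simp: nodes_def quotient_def)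
  have iff: "(\<forall>p \<in> preds T lt a. p \<prec> F (- k) y) \<longleftrightarrow> (\<forall>p \<in> preds T lt a. p \<prec> y)" if "y \<in> T" for y
    using above_P_iff[of "F (- k) y" k] that F_T_iff ipow_inverse[OF bij] k(2) P_0 by simp
  have "F k ` ?U = ?U" unfolding F_image_T using iff by auto
  then have "F k \<in> Cond ?U lt"
    using F_mono[of k] k(1) bij_is_inj[OF bij_ipow[OF bij, of k]]
    by (auto simp: Cond_def bij_betw_def intro: inj_on_subset)
  moreover have "hgt a <o hgt (F k a)"
  proof -
    have "F k a = F (k - 1) (f a)" using ipow_add[OF bij, of "k - 1" 1 a] by simp
    then have "hgt (f a) \<le>o hgt (F k a)" using Cond_hgt_le[OF F_Cond, of "k - 1" "f a"] k(1) a f_T_iff by simp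
    then show ?thesis using raised ordLess_ordLeq_trans by blast
  qed
  ultimately show "critical T lt ?N"
    unfolding critical_def up_closure_same_preds[OF a] using a by blast
qed

text \<open>
  Since \<open>f a\<close> is higher than \<open>a\<close>, a point \<open>c\<close> at the height of \<open>a\<close> lies below \<open>f a\<close>. Its preimage \<open>d\<close>
  is not low, as \<open>c\<close> is not, and not higher than \<open>c\<close>; so it has the height of \<open>a\<close>. As \<open>c\<close> lies above
  \<open>P 1\<close>, its preimage lies above \<open>P 0 = (\<cdot>,a)\<close>, and there is no room for further predecessors.
\<close>

lemma obtain_partner:
  obtains d where "d \<in> T" "preds T lt d = preds T lt a" "f d \<prec> f a"
proof -
  have faT: "f a \<in> T" using f_T_iff a by blast
  obtain c where "c \<in> preds T lt (f a)" and c: "hgt c =o hgt a"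
    using obtain_hgt_below[OF _ downset_preds[OF faT]] Well_order_hgt[OF faT] raised
    unfolding ht_def by blast
  then have cT: "c \<in> T" and c_less: "c \<prec> f a" by (auto simp: in_preds)
  define d where "d = F (- 1) c"
  have fd: "f d = c" using ipow_inverse[OF bij, of 1 c] by (simp add: d_def)
  have dT: "d \<in> T" using f_T_iff cT fd by blast
  have c_low: "c \<notin> low" using c not_ordLess_ordIso by (auto simp: low_def)
  then have "d \<notin> low" using f_low_iff fd by blast
  then have "hgt a \<le>o hgt d"
    using dT not_ordLess_iff_ordLeq[OF Well_order_hgt[OF a] Well_order_hgt[OF dT]] by (simp add: low_def)
  moreover have "hgt d \<le>o hgt a"
    using Cond_hgt_le[OF f_Cond dT] c ordLeq_ordIso_trans by (simp add: fd) blast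
  ultimately have d_hgt: "hgt a =o hgt d" by (simp add: ordIso_iff_ordLeq)
  have "p \<prec> c" if p: "p \<in> P 1" for p
  proof -
    have p': "p \<in> low" "p \<in> T" "p \<prec> f a"
      using p P_low low_T P_subset_preds[of 1] by (auto simp: in_preds)
    then show ?thesis
      using linear[OF faT p'(2) cT p'(3) c_less] downset_low[OF p'(1) cT] c_low by blast
  qed
  then have "\<forall>p \<in> preds T lt a. p \<prec> d" using above_P_iff[OF dT, of 1] fd by simp
  then have "preds T lt a \<subseteq> preds T lt d" by (auto simp: in_preds)
  then have "preds T lt a = preds T lt d"
    using downset_below_eqI[OF dT _ subset_refl downset_preds[OF a] downset_preds[OF dT]] d_hgt
    by (simp add: ht_def)
  then show ?thesis using that[OF dT] c_less fd by simp
qed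

text \<open>
  The orbits of the partner \<open>d\<close> and of \<open>a\<close> supply the two points over each chain. At index 0 they are
  incomparable and at index 1 comparable, and the positive powers of \<open>f\<close> carry comparability forward,
  hence incomparability backward.
\<close>

lemma archetypical_subtree_of_inj:
  assumes inj: "inj P"
  shows "\<exists>S. archetypical_subtree S T lt"
proof -
  obtain d where d: "d \<in> T" "preds T lt d = preds T lt a" and fd: "f d \<prec> f a"
    by (rule obtain_partner)
  define A B where "A n = F n d" and "B n = F n a" for n
  define S where "S = (\<Union>n. P n \<union> {A n, B n})"
  have AT: "A n \<in> T" and BT: "B n \<in> T" for n using F_T_iff d a by (auto simp: A_def B_def)
  have PA: "p \<prec> A n" and PB: "p \<prec> B n" if "p \<in> P n" for p n
    using that above_P_iff[OF d(1), of n] above_P_iff[OF a, of n] d(2)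
    by (auto simp: A_def B_def in_preds)
  have ad: "\<not> a \<prec> d" "\<not> d \<prec> a" using d irrefl a unfolding set_eq_iff in_preds by blast+
  have incomp: "incomparable lt (A n) (B n)" if n: "n \<le> 0" for n
  proof -
    have undo: "F (- n) (A n) = d" "F (- n) (B n) = a"
      using ipow_inverse[OF bij, of "- n"] by (simp_all add: A_def B_def)
    have "\<not> A n \<prec> B n" "\<not> B n \<prec> A n"
      using F_mono[of "- n" "A n" "B n"] F_mono[of "- n" "B n" "A n"] n AT BT ad undo by auto
    moreover have "A n \<noteq> B n" using undo fd irrefl f_T_iff a by auto
    ultimately show ?thesis by (auto simp: incomparable_def)
  qed
  have AB: "A n \<prec> B n" if n: "0 < n" for n
    using F_mono[of "n - 1" "f d" "f a"] n fd f_T_iff a d ipow_add[OF bij, of "n - 1" 1]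
    by (simp add: A_def B_def)
  have ne: "hgt a \<noteq> {}"
  proof
    assume "hgt a = {}"
    then have "preds T lt a = {}" using Field_hgt[of a] by simp
    then have "P 0 = P 1" by (simp add: P_def)
    then show False using inj by (simp add: inj_eq)
  qed
  have f_inj: "inj_on f (\<Union>n. P n)" using bij_is_inj[OF bij] by (auto intro: inj_on_subset)
  have f_iff: "f x \<prec> f y \<longleftrightarrow> x \<prec> y" if "x \<in> (\<Union>n. P n)" "y \<in> (\<Union>n. P n)" for x y
    using that f_less_iff P_low low_T by blast
  have f_P: "f ` P n = P (n + 1)" for n using P_add[of 1 n] by (simp add: add.commute)
  have arch: "archetypical_with S lt (hgt a) P A B f"
    unfolding S_def
    by (rule archetypical_withI;
        fact ne downset_P P_type inj AT BT PA PB incomp AB f_inj f_iff f_P)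
  have "f x = y" if "(x, y) \<in> shift_map S lt (hgt a) A B f" for x y
    using that ipow_succ[OF bij] by (auto simp: shift_map_def A_def B_def)
  moreover have "S \<subseteq> T" using P_low low_T AT BT by (auto simp: S_def)
  moreover have "preds T lt (A 0) = P 0" "preds T lt (B 0) = P 0"
    using d by (simp_all add: A_def B_def P_0)
  ultimately have "archetypical_subtree S T lt"
    unfolding archetypical_subtree_def using arch f_Cond by blast
  then show ?thesis ..
qed

lemma critical_node_or_archetypical_subtree:
  "(\<exists>N \<in> nodes T lt. critical T lt N) \<or> (\<exists>S. archetypical_subtree S T lt)"
proof (cases "inj P")
  case False
  then obtain m n where mn: "m \<noteq> n" "P m = P n" by (auto simp: inj_def)
  obtain i j where ij: "i < j" "P i = P j"
    using mn by (cases "m < n") (auto intro: that[of m n] that[of n m])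
  \<comment> \<open>The coincidence of two chains is moved back to \<open>P 0\<close> by cancelling \<open>F i\<close>.\<close>
  have "F i ` P (j - i) = F i ` P 0" using P_add[of i "j - i"] P_add[of i 0] ij(2) by simp
  then have "P (j - i) = P 0" using inj_image_eq_iff[OF bij_is_inj[OF bij_ipow[OF bij]]] by blast
  then show ?thesis using critical_node_of_a[of "j - i"] ij(1) by simp
qed (use archetypical_subtree_of_inj in blast)

end

text \<open>
  A condensation may be redefined as the identity outside \<open>T\<close>, which makes it bijective on the whole
  type. The point is found by well-foundedness of \<open><o\<close> on the heights of the points that are raised.
\<close>

lemma (in tree) not_reversible_obtain_lowest_raised:
  assumes "\<not> reversible T lt"
  obtains f a where "lowest_raised T lt f a"
proof -
  obtain h where h: "h \<in> Cond T lt" "h \<notin> Aut T lt"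
    using assms reversible_iff_Cond_subset_Aut by blast
  define f where "f x = (if x \<in> T then h x else x)" for x
  have "bij_betw f T T" using h(1) by (auto simp: f_def Cond_def cong: bij_betw_cong)
  moreover have "bij_betw f (- T) (- T)" by (auto simp: f_def bij_betw_def inj_on_def)
  ultimately have "bij_betw f (T \<union> - T) (T \<union> - T)" by (rule bij_betw_combine) auto
  then have bij: "bij f" by simp
  have f: "f \<in> Cond T lt" using h(1) \<open>bij_betw f T T\<close> by (auto simp: f_def Cond_def)
  have "f \<notin> Aut T lt" using h(2) \<open>bij_betw f T T\<close> h(1) by (auto simp: f_def Aut_def Cond_def)
  then obtain x where x: "x \<in> T" "\<not> hgt x =o hgt (f x)" using Cond_preserving_hgt_imp_Aut[OF f] by blast
  have raised: "hgt z <o hgt (f z)" if "z \<in> T" "\<not> hgt z =o hgt (f z)" for z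
    using Cond_hgt_le[OF f that(1)] that(2) ordLeq_iff_ordLess_or_ordIso by blast
  let ?R = "hgt ` {x \<in> T. \<not> hgt x =o hgt (f x)}"
  have "hgt x \<in> ?R" using x by blast
  then obtain r where r: "r \<in> ?R" "\<And>s. s <o r \<Longrightarrow> s \<notin> ?R"
    by (rule wfE_min[OF wf_ordLess]) (rule that)
  then obtain a where a: "a \<in> T" "\<not> hgt a =o hgt (f a)" "r = hgt a" by blast
  have "lowest_raised T lt f a"
    by unfold_locales (use f bij a raised r(2) in blast)+
  then show ?thesis by (rule that)
qed

theorem theorem4p2:
  fixes T :: "'a set" and lt :: "'a \<Rightarrow> 'a \<Rightarrow> bool"
  assumes "is_tree T lt"
  shows "\<not> reversible T lt \<longleftrightarrow>
    (\<exists>N \<in> nodes T lt. critical T lt N) \<or> (\<exists>S. archetypical_subtree S T lt)"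
proof -
  interpret tree T lt using assms by unfold_locales
  show ?thesis
    using not_reversible_obtain_lowest_raised lowest_raised.critical_node_or_archetypical_subtree
      critical_imp_not_reversible archetypical_subtree_imp_not_reversible by metis
qed

end
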